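(* There exists an indexed family of languages $\mathscr{L}$ that is identified by some HCEGIS engine but by no CEGIS engine; i.e. $\mathtt{HCEGIS}\not\subseteq\mathtt{CEGIS}$.
   Context: Languages are subsets of $\mathbb{N}$, ordered by the natural order of $\mathbb{N}$; $\overline{L}=\mathbb{N}\setminus L$. An indexed family of languages is a sequence $\mathscr{L}=L_0,L_1,\ldots$ of non-empty recursive languages for which there is a total recursive function $\mathtt{TEMPLATE}$ with $\mathtt{TEMPLATE}(i,n)=1$ if $n\in L_i$ and $0$ otherwise; the program $P_i$ is $n\mapsto\mathtt{TEMPLATE}(i,n)$, $\mathscr{P}=\{P_0,P_1,\ldots\}$, and $L(P_i)=L_i$. A sequence is a map $\sigma:\mathbb{N}\to\mathbb{N}\cup\{\bot\}$; $\sigma[k]$ is its prefix of length $k$, $\sigma(k)$ its $k$-th element, $\sigma_0$ the empty sequence, $\mathtt{SMPL}(\sigma)=\mathrm{range}(\sigma)\setminus\{\bot\}$. A trace for $L$ is a sequence $\tau$ with $\mathtt{SMPL}(\tau)=L$. A verifier $\mathtt{CHECK}_L$ is a (non-deterministic) map from $\mathscr{L}$ to $\mathbb{N}\cup\{\bot\}$ with $\mathtt{CHECK}_L(L_i)=\bot$ iff $L_i\subseteq L$ and otherwise $\mathtt{CHECK}_L(L_i)\in L_i\cap\overline{L}$. A history-bounded verifier $\mathtt{HCHECK}_L$ maps $L_i\in\mathscr{L}$ and a trace prefix $\tau[n]$ to $\mathbb{N}\cup\{\bot\}$: $\mathtt{HCHECK}_L(L_i,\tau[n])=m$ for some $m\in\overline{L}\cap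 L_i$ with $m<\tau(j)$ for some $j\le n$, if such $m$ exists, and $\bot$ otherwise. A CEGIS engine is given by a recursive $F:\mathscr{P}\times\mathbb{N}\times\mathbb{N}\to\mathscr{P}$ (counterexample argument may be $\bot$) and initial program $P_0$: $T(\sigma_0,\sigma_0)=P_0$, $T(\tau[n],\mathtt{cex}[n])=F(T(\tau[n-1],\mathtt{cex}[n-1]),\tau(n),\mathtt{cex}(n))$, where $\tau$ is a trace of the target language $L$ and $\mathtt{cex}(i)=\mathtt{CHECK}_L(L(T(\tau[i-1],\mathtt{cex}[i-1])))$. An HCEGIS engine is defined identically but with $\mathtt{cex}(i)=\mathtt{HCHECK}_L(L(T(\tau[i-1],\mathtt{cex}[i-1])),\tau[i-1])$. $T$ converges to $P_i$ on $(\tau,\mathtt{cex})$ if $T(\tau[n],\mathtt{cex}[n])=P_i$ for all sufficiently large $n$; $T$ identifies $L_i$ if it converges to $P_i$ for every trace $\tau$ of $L_i$ and every corresponding counterexample sequence; $T$ identifies $\mathscr{L}$ if it identifies every member. $\mathtt{CEGIS}$ (resp. $\mathtt{HCEGIS}$) is the class of indexed families identified by some CEGIS (resp. HCEGIS) engine. *)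

theory Defs
  imports Main
begin

text \<open>total_rec n f: f, restricted to argument lists of length n, is a total recursive
  function of n arguments. Built from zero, successor, projections by composition,
  primitive recursion and minimisation of regular functions (Kleene).\<close>

inductive total_rec :: "nat \<Rightarrow> (nat list \<Rightarrow> nat) \<Rightarrow> bool" where
  zero: "total_rec n (\<lambda>xs. 0)"
| succ: "total_rec 1 (\<lambda>xs. Suc (hd xs))"
| proj: "i < n \<Longrightarrow> total_rec n (\<lambda>xs. xs ! i)"
| comp: "total_rec m f \<Longrightarrow> length gs = m \<Longrightarrow> (\<forall>g\<in>set gs. total_rec n g) \<Longrightarrow>
           total_rec n (\<lambda>xs. f (map (\<lambda>g. g xs) gs))"
| prim: "total_rec n g \<Longrightarrow> total_rec (Suc (Suc n)) h \<Longrightarrow>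
           total_rec (Suc n) (\<lambda>xs. rec_nat (g (tl xs)) (\<lambda>k acc. h (k # acc # tl xs)) (hd xs))"
| mu: "total_rec (Suc n) g \<Longrightarrow> (\<forall>xs. length xs = n \<longrightarrow> (\<exists>y. g (y # xs) = 0)) \<Longrightarrow>
           total_rec n (\<lambda>xs. LEAST y. g (y # xs) = 0)"

definition enc_opt :: "nat option \<Rightarrow> nat" where
  "enc_opt x = (case x of None \<Rightarrow> 0 | Some k \<Rightarrow> Suc k)"

definition recursive2 :: "(nat \<Rightarrow> nat \<Rightarrow> nat) \<Rightarrow> bool" where
  "recursive2 f \<longleftrightarrow> (\<exists>g. total_rec 2 g \<and> (\<forall>a b. g [a, b] = f a b))"

definition recursive_F :: "(nat \<Rightarrow> nat option \<Rightarrow> nat option \<Rightarrow> nat) \<Rightarrow> bool" where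
  "recursive_F F \<longleftrightarrow>
     (\<exists>g. total_rec 3 g \<and> (\<forall>p x c. g [p, enc_opt x, enc_opt c] = F p x c))"

definition indexed_family :: "(nat \<Rightarrow> nat set) \<Rightarrow> bool" where
  "indexed_family \<L> \<longleftrightarrow> (\<forall>i. \<L> i \<noteq> {}) \<and>
     recursive2 (\<lambda>i n. if n \<in> \<L> i then 1 else 0)"

definition SMPL :: "(nat \<Rightarrow> nat option) \<Rightarrow> nat set" where
  "SMPL \<sigma> = {x. \<exists>k. \<sigma> k = Some x}"

definition is_trace :: "nat set \<Rightarrow> (nat \<Rightarrow> nat option) \<Rightarrow> bool" where
  "is_trace L \<tau> \<longleftrightarrow> SMPL \<tau> = L"

definition check_ok :: "nat set \<Rightarrow> nat set \<Rightarrow> nat option \<Rightarrow> bool" where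
  "check_ok L H c \<longleftrightarrow>
     (if H \<subseteq> L then c = None else (\<exists>m. c = Some m \<and> m \<in> H \<and> m \<notin> L))"

definition hcheck_ok :: "nat set \<Rightarrow> nat set \<Rightarrow> nat set \<Rightarrow> nat option \<Rightarrow> bool" where
  "hcheck_ok L H hist c \<longleftrightarrow>
     (if (\<exists>m. m \<in> H \<and> m \<notin> L \<and> (\<exists>t\<in>hist. m < t))
      then (\<exists>m. c = Some m \<and> m \<in> H \<and> m \<notin> L \<and> (\<exists>t\<in>hist. m < t))
      else c = None)"

definition history :: "(nat \<Rightarrow> nat option) \<Rightarrow> nat \<Rightarrow> nat set" where
  "history \<tau> n = {t. \<exists>j<n. \<tau> j = Some t}"

text \<open>Programs are represented by their indices: index p stands for P_p.
  run F p0 \<tau> cex n is the (index of the) program after consuming \<tau>(0..n-1) and cex(0..n-1).\<close>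
fun run :: "(nat \<Rightarrow> nat option \<Rightarrow> nat option \<Rightarrow> nat) \<Rightarrow> nat \<Rightarrow>
            (nat \<Rightarrow> nat option) \<Rightarrow> (nat \<Rightarrow> nat option) \<Rightarrow> nat \<Rightarrow> nat" where
  "run F p0 \<tau> cex 0 = p0"
| "run F p0 \<tau> cex (Suc n) = F (run F p0 \<tau> cex n) (\<tau> n) (cex n)"

text \<open>F is a well-defined recursive map on programs: programs P_p, P_q are equal (as
  functions) iff their languages coincide, so F must respect this equality.\<close>
definition engine :: "(nat \<Rightarrow> nat set) \<Rightarrow> (nat \<Rightarrow> nat option \<Rightarrow> nat option \<Rightarrow> nat) \<Rightarrow> bool" where
  "engine \<L> F \<longleftrightarrow> recursive_F F \<and>
     (\<forall>p q x c. \<L> p = \<L> q \<longrightarrow> \<L> (F p x c) = \<L> (F q x c))"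

definition converges_to :: "(nat \<Rightarrow> nat set) \<Rightarrow> (nat \<Rightarrow> nat) \<Rightarrow> nat \<Rightarrow> bool" where
  "converges_to \<L> h i \<longleftrightarrow> (\<exists>N. \<forall>n\<ge>N. \<L> (h n) = \<L> i)"

definition cegis_identifies ::
  "(nat \<Rightarrow> nat set) \<Rightarrow> (nat \<Rightarrow> nat option \<Rightarrow> nat option \<Rightarrow> nat) \<Rightarrow> nat \<Rightarrow> bool" where
  "cegis_identifies \<L> F p0 \<longleftrightarrow>
     (\<forall>i \<tau> cex. is_trace (\<L> i) \<tau> \<longrightarrow>
        (\<forall>n. check_ok (\<L> i) (\<L> (run F p0 \<tau> cex n)) (cex n)) \<longrightarrow>
        converges_to \<L> (run F p0 \<tau> cex) i)"

definition hcegis_identifies ::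
  "(nat \<Rightarrow> nat set) \<Rightarrow> (nat \<Rightarrow> nat option \<Rightarrow> nat option \<Rightarrow> nat) \<Rightarrow> nat \<Rightarrow> bool" where
  "hcegis_identifies \<L> F p0 \<longleftrightarrow>
     (\<forall>i \<tau> cex. is_trace (\<L> i) \<tau> \<longrightarrow>
        (\<forall>n. hcheck_ok (\<L> i) (\<L> (run F p0 \<tau> cex n)) (history \<tau> n) (cex n)) \<longrightarrow>
        converges_to \<L> (run F p0 \<tau> cex) i)"

definition in_CEGIS :: "(nat \<Rightarrow> nat set) \<Rightarrow> bool" where
  "in_CEGIS \<L> \<longleftrightarrow> indexed_family \<L> \<and> (\<exists>F p0. engine \<L> F \<and> cegis_identifies \<L> F p0)"

definition in_HCEGIS :: "(nat \<Rightarrow> nat set) \<Rightarrow> bool" where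
  "in_HCEGIS \<L> \<longleftrightarrow> indexed_family \<L> \<and> (\<exists>F p0. engine \<L> F \<and> hcegis_identifies \<L> F p0)"

end

theory Submission
  imports Defs "HOL-Library.Nat_Bijection"
begin

text \<open>
  The family consists of three infinite decoys \<open>decoy t\<close> and of finite languages \<open>finlang i q\<close> of kind \<open>i\<close>
  and level \<open>q\<close>. The kind fixes an odd marker, a finite set of even numbers below it, and one further
  even number below it, the gap. Level 0 has the marker and the set; level \<open>q > 0\<close> adds the gap
  and one even number \<open>2 * (i + q)\<close> above the marker, the top.

  With history-bounded counterexamples, the learner waits in a decoy for the marker and then tries
  the levels 1, 2, ... If the target has level 0, the gap is the only counterexample below the largest
  element of the target, so it is reported at once. Otherwise the true top bounds the history and the
  search stops there.

  With unbounded counterexamples, the gap need never be reported. A learner must visit decoy \<open>t\<close> on every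
  trace of it, and when it is then refuted it has forgotten all examples. If it has seen the gap, the
  top and elements of the set, it confuses level 0 with level \<open>q\<close>, unless it happens to try level \<open>q\<close>
  later (which for each kind concerns finitely many levels only) or has refuted the kind before
  (finitely many kinds only). Choosing new large tops over and over yields a trace of the decoy all of
  whose prefixes of length at least two are of this sort. One of the three decoys is not visited in the
  first two steps, hence never.
\<close>

section \<open>Closure properties of total recursive functions\<close>

definition computable :: "nat \<Rightarrow> (nat list \<Rightarrow> nat) \<Rightarrow> bool" where
  "computable n f \<longleftrightarrow> (\<exists>g. total_rec n g \<and> (\<forall>xs. length xs = n \<longrightarrow> g xs = f xs))"

lemma computable_cong:
  assumes "computable n f" "\<And>xs. length xs = n \<Longrightarrow> f xs = g xs"
  shows "computable n g"
  using assms unfolding computable_def by metis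

lemma computable_nth: "i < n \<Longrightarrow> computable n (\<lambda>xs. xs ! i)"
  unfolding computable_def using total_rec.proj by blast

lemma computable_comp:
  assumes f: "computable (length gs) f" and gs: "\<forall>g\<in>set gs. computable n g"
  shows "computable n (\<lambda>xs. f (map (\<lambda>g. g xs) gs))"
proof -
  obtain f' where f': "total_rec (length gs) f'" "\<And>xs. length xs = length gs \<Longrightarrow> f' xs = f xs"
    using f unfolding computable_def by blast
  obtain r where r: "\<And>g. g \<in> set gs \<Longrightarrow> total_rec n (r g) \<and> (\<forall>xs. length xs = n \<longrightarrow> r g xs = g xs)"
    using gs unfolding computable_def by metis
  have "total_rec n (\<lambda>xs. f' (map (\<lambda>g. g xs) (map r gs)))"
    by (rule total_rec.comp[OF f'(1)]) (use r in auto)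
  moreover have "f' (map (\<lambda>g. g xs) (map r gs)) = f (map (\<lambda>g. g xs) gs)" if "length xs = n" for xs
  proof -
    have "map (\<lambda>g. g xs) (map r gs) = map (\<lambda>g. g xs) gs"
      using r that by auto
    then show ?thesis using f'(2)[of "map (\<lambda>g. g xs) gs"] by (metis length_map)
  qed
  ultimately show ?thesis unfolding computable_def by blast
qed

lemma computable_comp1:
  assumes "computable 1 (\<lambda>xs. f (xs ! 0))" "computable n g"
  shows "computable n (\<lambda>xs. f (g xs))"
  using computable_comp[of "[g]" "\<lambda>xs. f (xs ! 0)" n] assms by simp

lemma computable_comp2:
  assumes "computable 2 (\<lambda>xs. f (xs ! 0) (xs ! 1))" "computable n g" "computable n h"
  shows "computable n (\<lambda>xs. f (g xs) (h xs))"
  using computable_comp[of "[g, h]" "\<lambda>xs. f (xs ! 0) (xs ! 1)" n] assms by (simp add: numeral_2_eq_2)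

lemma computable_Suc: "computable n f \<Longrightarrow> computable n (\<lambda>xs. Suc (f xs))"
proof (rule computable_comp1[where f = Suc])
  show "computable 1 (\<lambda>xs. Suc (xs ! 0))"
    unfolding computable_def
    by (intro exI[of _ "\<lambda>xs. Suc (hd xs)"] conjI total_rec.succ) (auto simp: length_Suc_conv)
qed

lemma computable_const: "computable n (\<lambda>xs. c)"
proof (induction c)
  case 0
  show ?case unfolding computable_def using total_rec.zero by blast
next
  case (Suc c)
  then show ?case by (rule computable_Suc)
qed

lemma computable_prim_rec:
  assumes b: "computable 1 (\<lambda>xs. b (xs ! 0))"
    and s: "computable 3 (\<lambda>xs. s (xs ! 0) (xs ! 1) (xs ! 2))"
    and f: "\<And>y. f 0 y = b y" "\<And>k y. f (Suc k) y = s k (f k y) y"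
  shows "computable 2 (\<lambda>xs. f (xs ! 0) (xs ! 1))"
proof -
  obtain b' where b': "total_rec 1 b'" "\<And>y. b' [y] = b y"
    using b unfolding computable_def by force
  obtain s' where s': "total_rec 3 s'" "\<And>x y z. s' [x, y, z] = s x y z"
    using s unfolding computable_def by (force simp: numeral_3_eq_3)
  have "total_rec (Suc 1) (\<lambda>xs. rec_nat (b' (tl xs)) (\<lambda>k acc. s' (k # acc # tl xs)) (hd xs))"
    by (rule total_rec.prim) (use b' s' in \<open>simp_all add: numeral_3_eq_3\<close>)
  moreover have "rec_nat (b' [y]) (\<lambda>k acc. s' [k, acc, y]) x = f x y" for x y
    by (induction x) (simp_all add: b' s' f)
  ultimately show ?thesis
    unfolding computable_def
    by (intro exI conjI) (auto simp: numeral_2_eq_2 length_Suc_conv)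
qed

lemma computable_add: "computable n f \<Longrightarrow> computable n g \<Longrightarrow> computable n (\<lambda>xs. f xs + g xs)"
proof (rule computable_comp2[where f = "(+)"])
  show "computable 2 (\<lambda>xs. xs ! 0 + xs ! 1)"
    by (rule computable_prim_rec[where f = "(+)" and b = "\<lambda>y. y" and s = "\<lambda>k r y. Suc r"])
      (intro computable_nth computable_Suc | simp)+
qed

lemma computable_mult: "computable n f \<Longrightarrow> computable n g \<Longrightarrow> computable n (\<lambda>xs. f xs * g xs)"
proof (rule computable_comp2[where f = "(*)"])
  show "computable 2 (\<lambda>xs. xs ! 0 * xs ! 1)"
    by (rule computable_prim_rec[where f = "(*)" and b = "\<lambda>y. 0" and s = "\<lambda>k r y. r + y"])
      (intro computable_nth computable_const computable_add | simp)+
qed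

lemma computable_power: "computable n f \<Longrightarrow> computable n g \<Longrightarrow> computable n (\<lambda>xs. f xs ^ g xs)"
proof (rule computable_comp2[where f = "\<lambda>k y. y ^ k"])
  show "computable 2 (\<lambda>xs. xs ! 1 ^ xs ! 0)"
    by (rule computable_prim_rec[where f = "\<lambda>k y. y ^ k" and b = "\<lambda>y. 1" and s = "\<lambda>k r y. y * r"])
      (intro computable_nth computable_const computable_mult | simp)+
qed

lemma computable_diff: "computable n f \<Longrightarrow> computable n g \<Longrightarrow> computable n (\<lambda>xs. f xs - g xs)"
proof (rule computable_comp2[where f = "\<lambda>k y. y - k"])
  have pred: "computable 2 (\<lambda>xs. xs ! 0 - 1)"
    by (rule computable_prim_rec[where f = "\<lambda>x y. x - 1" and b = "\<lambda>y. 0" and s = "\<lambda>k r y. k"])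
      (intro computable_nth computable_const | simp)+
  have pred_comp: "computable m (\<lambda>xs. h xs - 1)" if "computable m h" for m h
    by (rule computable_comp2[where f = "\<lambda>x y. x - 1", OF pred that that])
  show "computable 2 (\<lambda>xs. xs ! 1 - xs ! 0)"
    by (rule computable_prim_rec[where f = "\<lambda>k y. y - k" and b = "\<lambda>y. y" and s = "\<lambda>k r y. r - 1"])
      (intro computable_nth pred_comp | simp)+
qed

definition decidable :: "nat \<Rightarrow> (nat list \<Rightarrow> bool) \<Rightarrow> bool" where
  "decidable n P \<longleftrightarrow> computable n (\<lambda>xs. if P xs then 1 else 0)"

lemma computable_if:
  assumes "decidable n P" "computable n f" "computable n g"
  shows "computable n (\<lambda>xs. if P xs then f xs else g xs)"
proof -
  have "computable n (\<lambda>xs. (if P xs then 1 else 0) * f xs + (1 - (if P xs then 1 else 0)) * g xs)"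
    using assms unfolding decidable_def
    by (intro computable_add computable_mult computable_diff computable_const)
  then show ?thesis by (rule computable_cong) auto
qed

lemma decidable_le: "computable n f \<Longrightarrow> computable n g \<Longrightarrow> decidable n (\<lambda>xs. f xs \<le> g xs)"
  unfolding decidable_def
  by (rule computable_cong[where f = "\<lambda>xs. 1 - (f xs - g xs)"])
    (auto intro: computable_diff computable_const)

lemma decidable_not: "decidable n P \<Longrightarrow> decidable n (\<lambda>xs. \<not> P xs)"
  unfolding decidable_def
  by (rule computable_cong[where f = "\<lambda>xs. 1 - (if P xs then 1 else 0)"])
    (auto intro: computable_diff computable_const)

lemma decidable_conj: "decidable n P \<Longrightarrow> decidable n Q \<Longrightarrow> decidable n (\<lambda>xs. P xs \<and> Q xs)"
  unfolding decidable_def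
  by (rule computable_cong[where f = "\<lambda>xs. (if P xs then 1 else 0) * (if Q xs then 1 else 0)"])
    (auto intro: computable_mult)

lemma decidable_disj: "decidable n P \<Longrightarrow> decidable n Q \<Longrightarrow> decidable n (\<lambda>xs. P xs \<or> Q xs)"
  using decidable_not[OF decidable_conj[OF decidable_not decidable_not], of n P Q] by simp

lemma decidable_less: "computable n f \<Longrightarrow> computable n g \<Longrightarrow> decidable n (\<lambda>xs. f xs < g xs)"
  using decidable_not[OF decidable_le, of n g f] by (simp add: not_le)

lemma decidable_eq: "computable n f \<Longrightarrow> computable n g \<Longrightarrow> decidable n (\<lambda>xs. f xs = g xs)"
  using decidable_conj[OF decidable_le decidable_le, of n f g g f] by (simp add: eq_iff)

lemma computable_Least:
  assumes P: "decidable (Suc n) (\<lambda>xs. P (hd xs) (tl xs))"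
    and ex: "\<And>xs. length xs = n \<Longrightarrow> \<exists>y. P y xs"
  shows "computable n (\<lambda>xs. LEAST y. P y xs)"
proof -
  have "computable (Suc n) (\<lambda>xs. if P (hd xs) (tl xs) then 0 else 1)"
    by (intro computable_if P computable_const)
  then obtain g where g: "total_rec (Suc n) g"
      "\<And>xs. length xs = Suc n \<Longrightarrow> g xs = (if P (hd xs) (tl xs) then 0 else 1)"
    unfolding computable_def by blast
  then have g_eq_0: "g (y # xs) = 0 \<longleftrightarrow> P y xs" if "length xs = n" for xs y
    using that by simp
  then have "total_rec n (\<lambda>xs. LEAST y. g (y # xs) = 0)"
    using ex by (intro total_rec.mu[OF g(1)]) simp
  then show ?thesis
    unfolding computable_def using g_eq_0 by (intro exI conjI) auto
qed

lemma computable_hd: "0 < n \<Longrightarrow> computable n hd"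
  by (rule computable_cong[OF computable_nth[of 0]]) (auto simp: hd_conv_nth)

lemma computable_nth_tl: "Suc i < n \<Longrightarrow> computable n (\<lambda>xs. tl xs ! i)"
  by (rule computable_cong[OF computable_nth[of "Suc i"]]) (auto simp: nth_tl)

lemma computable_div:
  assumes "computable n f" "computable n g"
  shows "computable n (\<lambda>xs. f xs div g xs)"
proof (rule computable_comp2[OF _ assms])
  have "computable 2 (\<lambda>xs. LEAST y. xs ! 1 = 0 \<or> xs ! 0 < xs ! 1 * Suc y)"
  proof (rule computable_Least)
    show "decidable (Suc 2) (\<lambda>xs. tl xs ! 1 = 0 \<or> tl xs ! 0 < tl xs ! 1 * Suc (hd xs))"
      by (intro decidable_disj decidable_eq decidable_less computable_mult computable_Suc
          computable_const computable_nth_tl computable_hd) simp_all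
    show "\<exists>y. xs ! 1 = 0 \<or> xs ! 0 < xs ! 1 * Suc y" for xs :: "nat list"
      by (rule exI[of _ "xs ! 0"]) (cases "xs ! 1"; simp)
  qed
  moreover have "(LEAST y. b = 0 \<or> a < b * Suc y) = a div b" for a b :: nat
  proof (rule Least_equality)
    show "b = 0 \<or> a < b * Suc (a div b)"
      using dividend_less_times_div[of b a] by (cases "b = 0") auto
    show "a div b \<le> y" if "b = 0 \<or> a < b * Suc y" for y
      using that by (auto simp: less_mult_imp_div_less mult.commute simp flip: less_Suc_eq_le)
  qed
  ultimately show "computable 2 (\<lambda>xs. xs ! 0 div xs ! 1)" by simp
qed

lemma decidable_even:
  assumes "computable n f"
  shows "decidable n (\<lambda>xs. even (f xs))"
proof -
  have "decidable n (\<lambda>xs. f xs \<le> 2 * (f xs div 2))"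
    by (intro decidable_le computable_mult computable_div computable_const assms)
  moreover have "m \<le> 2 * (m div 2) \<longleftrightarrow> even m" for m :: nat by presburger
  ultimately show ?thesis by simp
qed

lemmas computable_intros =
  computable_nth computable_hd computable_nth_tl computable_const computable_Suc computable_add
  computable_mult computable_power computable_diff computable_div computable_if decidable_le
  decidable_less decidable_eq decidable_not decidable_conj decidable_disj decidable_even

lemma decidable_mem_set_decode:
  assumes "computable n f" "computable n g"
  shows "decidable n (\<lambda>xs. f xs \<in> set_decode (g xs))"
  unfolding set_decode_def mem_Collect_eq by (intro computable_intros assms)

lemma computable_triangle: "computable n f \<Longrightarrow> computable n (\<lambda>xs. triangle (f xs))"
  unfolding triangle_def by (intro computable_intros)

lemma computable_prod_encode:
  assumes "computable n f" "computable n g"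
  shows "computable n (\<lambda>xs. prod_encode (f xs, g xs))"
  unfolding prod_encode_def prod.case by (intro computable_intros computable_triangle assms)

definition diagonal :: "nat \<Rightarrow> nat" where
  "diagonal n = (LEAST k. n < triangle (Suc k))"

lemma diagonal_prod_encode: "diagonal (prod_encode (i, q)) = i + q"
  unfolding diagonal_def prod_encode_def prod.case
proof (rule Least_equality)
  show "triangle (i + q) + i < triangle (Suc (i + q))" by simp
  show "i + q \<le> k" if "triangle (i + q) + i < triangle (Suc k)" for k
  proof (rule ccontr)
    assume "\<not> i + q \<le> k"
    then have "triangle (Suc k) \<le> triangle (i + q)"
      unfolding triangle_def by (intro div_le_mono mult_le_mono) simp_all
    then show False using that by simp
  qed
qed

lemma prod_decode_eq_diagonal:
  "fst (prod_decode n) = n - triangle (diagonal n)"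
  "snd (prod_decode n) = diagonal n - fst (prod_decode n)"
proof -
  obtain i q where "n = prod_encode (i, q)" by (metis prod_decode_inverse surj_pair)
  then show "fst (prod_decode n) = n - triangle (diagonal n)"
      "snd (prod_decode n) = diagonal n - fst (prod_decode n)"
    by (simp_all add: diagonal_prod_encode) (simp add: prod_encode_def)
qed

lemma computable_diagonal: "computable n f \<Longrightarrow> computable n (\<lambda>xs. diagonal (f xs))"
proof (rule computable_comp1[where f = diagonal])
  show "computable 1 (\<lambda>xs. diagonal (xs ! 0))"
    unfolding diagonal_def
  proof (rule computable_Least)
    show "decidable (Suc 1) (\<lambda>xs. tl xs ! 0 < triangle (Suc (hd xs)))"
      by (intro computable_intros computable_triangle) simp_all
    show "\<exists>k. xs ! 0 < triangle (Suc k)" for xs :: "nat list"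
      by (rule exI[of _ "xs ! 0"]) simp
  qed
qed

lemma computable_prod_decode:
  assumes "computable n f"
  shows "computable n (\<lambda>xs. fst (prod_decode (f xs)))"
    and "computable n (\<lambda>xs. snd (prod_decode (f xs)))"
  unfolding prod_decode_eq_diagonal
  by (intro computable_diff computable_triangle computable_diagonal assms)+

section \<open>The family\<close>

text \<open>A kind encodes a triple: a finite set, the gap cut out of it, and a free third component that
  makes every pair of base and gap occur infinitely often.\<close>

definition gap :: "nat \<Rightarrow> nat" where
  "gap i = fst (prod_decode (snd (prod_decode i)))"

definition base :: "nat \<Rightarrow> nat set" where
  "base i = set_decode (fst (prod_decode i)) - {gap i}"

definition body :: "nat \<Rightarrow> nat \<Rightarrow> nat set" where
  "body i q = base i \<union> (if q = 0 then {} else {gap i, i + q})"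

definition finlang :: "nat \<Rightarrow> nat \<Rightarrow> nat set" where
  "finlang i q = insert (2 * i + 1) ((*) 2 ` body i q)"

definition decoy :: "nat \<Rightarrow> nat set" where
  "decoy t = (*) 2 ` insert t {3..}"

definition idx :: "nat \<Rightarrow> nat \<Rightarrow> nat" where
  "idx i q = 3 + prod_encode (i, q)"

definition kind :: "nat \<Rightarrow> nat" where
  "kind p = fst (prod_decode (p - 3))"

definition level :: "nat \<Rightarrow> nat" where
  "level p = snd (prod_decode (p - 3))"

definition lang :: "nat \<Rightarrow> nat set" where
  "lang p = (if p < 3 then decoy p else finlang (kind p) (level p))"

lemma kind_idx [simp]: "kind (idx i q) = i"
  and level_idx [simp]: "level (idx i q) = q"
  by (simp_all add: kind_def level_def idx_def)

lemma idx_eq_iff [simp]: "idx i q = idx j r \<longleftrightarrow> i = j \<and> q = r"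
  by (simp add: idx_def)

lemma not_idx_less_3 [simp]: "\<not> idx i q < 3"
  by (simp add: idx_def)

lemma index_cases [case_names decoy finlang]:
  obtains "p < 3" | i q where "p = idx i q"
proof (cases "p < 3")
  case False
  then have "p = idx (kind p) (level p)" by (simp add: idx_def kind_def level_def)
  then show thesis by (rule that(2))
qed

lemma lang_idx [simp]: "lang (idx i q) = finlang i q"
  by (simp add: lang_def)

lemma lang_decoy [simp]: "t < 3 \<Longrightarrow> lang t = decoy t"
  by (simp add: lang_def)

lemma mem_decoy_iff: "x \<in> decoy t \<longleftrightarrow> even x \<and> (x = 2 * t \<or> 6 \<le> x)"
  by (auto simp: decoy_def image_iff elim!: evenE)

lemma mem_finlang_iff: "x \<in> finlang i q \<longleftrightarrow> x = 2 * i + 1 \<or> even x \<and> x div 2 \<in> body i q"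
  by (auto simp: finlang_def elim!: evenE)

lemma odd_mem_finlang [simp]: "odd x \<Longrightarrow> x \<in> finlang i q \<longleftrightarrow> x = 2 * i + 1"
  by (simp add: mem_finlang_iff)

lemma even_mem_finlang [simp]: "2 * n \<in> finlang i q \<longleftrightarrow> n \<in> body i q"
proof -
  have "2 * n \<noteq> 2 * i + 1" by presburger
  then show ?thesis by (simp add: mem_finlang_iff)
qed

lemma mem_set_decode_less:
  assumes "n \<in> set_decode e"
  shows "n < e"
proof -
  have "set_decode (2 ^ n) \<subseteq> set_decode e"
    using assms set_encode_inverse[of "{n}"] by (simp add: set_encode_def)
  then have "2 ^ n \<le> e" by (rule subset_decode_imp_le)
  then show ?thesis using less_exp[of n] by linarith
qed

lemma base_less: "n \<in> base i \<Longrightarrow> n < i"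
  using mem_set_decode_less[of n "fst (prod_decode i)"]
    le_prod_encode_1[of "fst (prod_decode i)" "snd (prod_decode i)"]
  by (simp add: base_def)

lemma gap_le: "gap i \<le> i"
proof -
  have "gap i \<le> snd (prod_decode i)"
    using le_prod_encode_1[of "gap i" "snd (prod_decode (snd (prod_decode i)))"]
    by (simp add: gap_def)
  also have "\<dots> \<le> i"
    using le_prod_encode_2[of "snd (prod_decode i)" "fst (prod_decode i)"] by simp
  finally show ?thesis .
qed

lemma gap_mem_body: "gap i \<in> body i q \<longleftrightarrow> 0 < q"
  using gap_le[of i] by (auto simp: body_def base_def)

lemma top_mem_body: "0 < r \<Longrightarrow> i + r \<in> body i q \<longleftrightarrow> q = r"
  using gap_le[of i] base_less[of "i + r" i] by (auto simp: body_def)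

lemma body_0_less: "n \<in> body i 0 \<Longrightarrow> n < i"
  using base_less by (simp add: body_def)

lemma decoy_neq_finlang: "decoy t \<noteq> finlang i q"
proof
  assume "decoy t = finlang i q"
  then show False using mem_decoy_iff[of "2 * i + 1" t] by simp
qed

lemma decoy_less_3_diff: "p < 3 \<Longrightarrow> p \<noteq> t \<Longrightarrow> 2 * p \<in> decoy p - decoy t"
  by (simp add: mem_decoy_iff)

lemma finlang_eq_iff: "finlang i q = finlang j r \<longleftrightarrow> i = j \<and> q = r"
proof
  assume eq: "finlang i q = finlang j r"
  then have "i = j"
    using odd_mem_finlang[of "2 * i + 1" i q] odd_mem_finlang[of "2 * i + 1" j r] by simp
  moreover have "body i q = body j r" using eq even_mem_finlang by blast
  ultimately show "i = j \<and> q = r" using top_mem_body by (metis gr0I)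
qed simp

lemma inj_lang: "inj lang"
proof (rule injI)
  fix p p'
  assume eq: "lang p = lang p'"
  show "p = p'"
  proof (cases p rule: index_cases)
    case decoy
    then have "p' < 3"
      using eq by (cases p' rule: index_cases) (simp_all add: decoy_neq_finlang)
    then show ?thesis using eq decoy decoy_less_3_diff[of p p'] by auto
  next
    case (finlang i q)
    then show ?thesis
      using eq decoy_neq_finlang[of p' i q]
      by (cases p' rule: index_cases) (auto simp: finlang_eq_iff)
  qed
qed

lemma computable_idx:
  assumes "computable n f" "computable n g"
  shows "computable n (\<lambda>xs. idx (f xs) (g xs))"
  unfolding idx_def by (intro computable_intros computable_prod_encode assms)

lemma computable_kind: "computable n f \<Longrightarrow> computable n (\<lambda>xs. kind (f xs))"
  unfolding kind_def by (intro computable_intros computable_prod_decode)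

lemma computable_level: "computable n f \<Longrightarrow> computable n (\<lambda>xs. level (f xs))"
  unfolding level_def by (intro computable_intros computable_prod_decode)

lemma decidable_mem_decoy:
  assumes "computable n f" "computable n g"
  shows "decidable n (\<lambda>xs. f xs \<in> decoy (g xs))"
  unfolding mem_decoy_iff by (intro computable_intros assms)

lemma decidable_mem_body:
  assumes f: "computable n f" and i: "computable n i" and q: "computable n q"
  shows "decidable n (\<lambda>xs. f xs \<in> body (i xs) (q xs))"
proof -
  have "decidable n (\<lambda>xs.
      f xs \<in> set_decode (fst (prod_decode (i xs))) \<and> \<not> f xs = gap (i xs) \<or>
      0 < q xs \<and> (f xs = gap (i xs) \<or> f xs = i xs + q xs))"
    unfolding gap_def
    by (intro computable_intros decidable_mem_set_decode computable_prod_decode assms)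
  then show ?thesis
    unfolding decidable_def by (rule computable_cong) (simp add: body_def base_def)
qed

lemma indexed_family_lang: "indexed_family lang"
proof -
  have "decidable 2 (\<lambda>xs. xs ! 0 < 3 \<and> xs ! 1 \<in> decoy (xs ! 0) \<or>
      \<not> xs ! 0 < 3 \<and> (xs ! 1 = 2 * kind (xs ! 0) + 1 \<or>
        even (xs ! 1) \<and> xs ! 1 div 2 \<in> body (kind (xs ! 0)) (level (xs ! 0))))"
    by (intro computable_intros decidable_mem_decoy decidable_mem_body computable_kind
        computable_level) simp_all
  then obtain g where g: "total_rec 2 g"
      "\<And>xs. length xs = 2 \<Longrightarrow> g xs = (if xs ! 1 \<in> lang (xs ! 0) then 1 else 0)"
    unfolding decidable_def computable_def by (auto simp: lang_def mem_finlang_iff)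
  have "g [p, x] = (if x \<in> lang p then 1 else 0)" for p x
    using g(2)[of "[p, x]"] by simp
  then have "recursive2 (\<lambda>p x. if x \<in> lang p then 1 else 0)"
    unfolding recursive2_def using g(1) by blast
  moreover have "lang p \<noteq> {}" for p
    by (simp add: lang_def decoy_def finlang_def)
  ultimately show ?thesis unfolding indexed_family_def by blast
qed

section \<open>Identification with history-bounded counterexamples\<close>

lemma is_trace_subset: "is_trace L \<tau> \<Longrightarrow> set_option (\<tau> n) \<subseteq> L"
  by (auto simp: is_trace_def SMPL_def)

lemma hcheck_ok_Some:
  assumes "hcheck_ok L H (history \<tau> n) (Some m)" "is_trace L \<tau>"
  obtains t where "m \<in> H" "m \<notin> L" "t \<in> L" "m < t"
  using assms by (auto simp: hcheck_ok_def is_trace_def SMPL_def history_def split: if_splits)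

lemma hcheck_ok_None: "hcheck_ok L H hist None \<Longrightarrow> m \<in> H \<Longrightarrow> m \<notin> L \<Longrightarrow> t \<in> hist \<Longrightarrow> t \<le> m"
  by (auto simp: hcheck_ok_def not_less split: if_splits)

lemma eventually_mem_history:
  assumes "is_trace L \<tau>" "x \<in> L"
  obtains N where "\<And>n. N \<le> n \<Longrightarrow> x \<in> history \<tau> n"
proof -
  obtain k where "\<tau> k = Some x" using assms by (auto simp: is_trace_def SMPL_def)
  then have "x \<in> history \<tau> n" if "Suc k \<le> n" for n using that by (auto simp: history_def Suc_le_eq)
  then show thesis by (rule that)
qed

lemma descent_eventually_constant:
  fixes h :: "nat \<Rightarrow> 'a" and rk :: "'a \<Rightarrow> nat"
  assumes start: "h N \<in> S"
    and step: "\<And>n. h n \<in> S \<Longrightarrow> h (Suc n) = h n \<and> Q n \<or> h (Suc n) \<in> S \<and> rk (h (Suc n)) < rk (h n)"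
  obtains M where "h M \<in> S" "\<And>n. M \<le> n \<Longrightarrow> h n = h M \<and> Q n"
proof -
  have in_S: "h n \<in> S" if "N \<le> n" for n
    using that by (induction n rule: dec_induct) (use start step in \<open>fastforce+\<close>)
  obtain M where M: "N \<le> M" and minimal: "\<And>n. N \<le> n \<Longrightarrow> rk (h M) \<le> rk (h n)"
    using ex_has_least_nat[of "\<lambda>n. N \<le> n" N "\<lambda>n. rk (h n)"] by blast
  have stays: "h (Suc n) = h n \<and> Q n" if "M \<le> n" "h n = h M" for n
    using step[OF in_S[of n]] minimal[of "Suc n"] M that by auto
  have "h n = h M" if "M \<le> n" for n
    using that by (induction n rule: dec_induct) (simp_all add: stays)
  then show thesis using that[of M] in_S[OF M] stays by blast
qed

lemma hcheck_descent_converges: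
  fixes rk :: "nat \<Rightarrow> nat"
  assumes trace: "is_trace (\<L> i) \<tau>"
    and ok: "\<And>n. hcheck_ok (\<L> i) (\<L> (run F p0 \<tau> cex n)) (history \<tau> n) (cex n)"
    and start: "run F p0 \<tau> cex N \<in> S"
    and stay: "\<And>p x. p \<in> S \<Longrightarrow> set_option x \<subseteq> \<L> i \<Longrightarrow> F p x None = p"
    and descend: "\<And>p x m t. p \<in> S \<Longrightarrow> set_option x \<subseteq> \<L> i \<Longrightarrow> m \<in> \<L> p \<Longrightarrow> m \<notin> \<L> i \<Longrightarrow>
      t \<in> \<L> i \<Longrightarrow> m < t \<Longrightarrow> F p x (Some m) \<in> S \<and> rk (F p x (Some m)) < rk p"
    and refutable: "\<And>p. p \<in> S \<Longrightarrow> \<L> p \<noteq> \<L> i \<Longrightarrow> \<exists>m t. m \<in> \<L> p \<and> m \<notin> \<L> i \<and> t \<in> \<L> i \<and> m < t"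
  shows "converges_to \<L> (run F p0 \<tau> cex) i"
proof -
  let ?h = "run F p0 \<tau> cex"
  have "?h (Suc n) = ?h n \<and> cex n = None \<or> ?h (Suc n) \<in> S \<and> rk (?h (Suc n)) < rk (?h n)"
    if "?h n \<in> S" for n
  proof (cases "cex n")
    case None
    then show ?thesis using stay[OF that is_trace_subset[OF trace]] by simp
  next
    case (Some m)
    then obtain t where "m \<in> \<L> (?h n)" "m \<notin> \<L> i" "t \<in> \<L> i" "m < t"
      using ok[of n] trace by (metis hcheck_ok_Some)
    then show ?thesis using descend[OF that is_trace_subset[OF trace]] Some by simp
  qed
  then obtain M where M: "?h M \<in> S" and const: "\<And>n. M \<le> n \<Longrightarrow> ?h n = ?h M \<and> cex n = None"
    using descent_eventually_constant[of ?h N S "\<lambda>n. cex n = None" rk] start by blast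
  have "\<L> (?h M) = \<L> i"
  proof (rule ccontr)
    assume "\<L> (?h M) \<noteq> \<L> i"
    then obtain m t where m: "m \<in> \<L> (?h M)" "m \<notin> \<L> i" "m < t" and t: "t \<in> \<L> i"
      using refutable M by blast
    obtain K where K: "\<And>n. K \<le> n \<Longrightarrow> t \<in> history \<tau> n"
      using eventually_mem_history[OF trace t] by blast
    have "hcheck_ok (\<L> i) (\<L> (?h M)) (history \<tau> (max M K)) None"
      using ok[of "max M K"] const[of "max M K"] by simp
    then have "t \<le> m" using m(1,2) K[of "max M K"] by (rule hcheck_ok_None) simp
    then show False using m(3) by simp
  qed
  then show ?thesis unfolding converges_to_def using const by metis
qed

definition next_decoy :: "nat \<Rightarrow> nat option \<Rightarrow> nat" where
  "next_decoy p c = (if c = None \<or> 2 \<le> p then p else p + 1)"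

definition refine :: "nat \<Rightarrow> nat option \<Rightarrow> nat" where
  "refine p c = (case c of None \<Rightarrow> p
     | Some m \<Rightarrow> if m \<le> 2 * kind p + 1 then idx (kind p) 0 else idx (kind p) (level p + 1))"

definition hstep :: "nat \<Rightarrow> nat option \<Rightarrow> nat option \<Rightarrow> nat" where
  "hstep p x c = (if p < 3
     then case x of None \<Rightarrow> next_decoy p c
       | Some y \<Rightarrow> if odd y then idx (y div 2) 1 else next_decoy p c
     else refine p c)"

lemma recursive_hstep: "recursive_F hstep"
proof -
  have "computable 3 (\<lambda>xs. if xs ! 0 < 3
      then if 0 < xs ! 1 \<and> even (xs ! 1) then idx ((xs ! 1 - 1) div 2) 1
        else if xs ! 2 = 0 \<or> 2 \<le> xs ! 0 then xs ! 0 else xs ! 0 + 1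
      else if xs ! 2 = 0 then xs ! 0
      else if xs ! 2 - 1 \<le> 2 * kind (xs ! 0) + 1 then idx (kind (xs ! 0)) 0
      else idx (kind (xs ! 0)) (level (xs ! 0) + 1))" (is "computable 3 ?f")
    by (intro computable_intros computable_idx computable_kind computable_level) simp_all
  then obtain g where g: "total_rec 3 g" "\<And>xs. length xs = 3 \<Longrightarrow> g xs = ?f xs"
    unfolding computable_def by blast
  have "g [p, enc_opt x, enc_opt c] = hstep p x c" for p x c
    using g(2)[of "[p, enc_opt x, enc_opt c]"]
    by (auto simp: hstep_def next_decoy_def refine_def enc_opt_def split: option.split)
  then show ?thesis unfolding recursive_F_def using g(1) by blast
qed

lemma hstep_idx: "hstep (idx i q) x c = refine (idx i q) c"
  by (simp add: hstep_def)

lemma hstep_marker: "p < 3 \<Longrightarrow> hstep p (Some (2 * i + 1)) c = idx i 1"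
  by (simp add: hstep_def)

lemma hstep_decoy:
  assumes "p < 3" "\<forall>y\<in>set_option x. even y"
  shows "hstep p x c = next_decoy p c"
  using assms by (auto simp: hstep_def split: option.split)

lemma hstep_converges_decoy:
  assumes t: "t < 3" and trace: "is_trace (lang t) \<tau>"
    and ok: "\<And>n. hcheck_ok (lang t) (lang (run hstep 0 \<tau> cex n)) (history \<tau> n) (cex n)"
  shows "converges_to lang (run hstep 0 \<tau> cex) t"
proof (rule hcheck_descent_converges[where N = 0 and S = "{..t}" and rk = "\<lambda>p. t - p", OF trace ok])
  show "run hstep 0 \<tau> cex 0 \<in> {..t}" by simp
next
  fix p x
  assume p: "p \<in> {..t}" and x: "set_option x \<subseteq> lang t"
  have "\<forall>y\<in>set_option x. even y" using x t by (auto simp: mem_decoy_iff)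
  then have step: "hstep p x c = next_decoy p c" for c using p t by (intro hstep_decoy) simp_all
  show "hstep p x None = p" by (simp add: step next_decoy_def)
  show "hstep p x (Some m) \<in> {..t} \<and> t - hstep p x (Some m) < t - p"
    if "m \<in> lang p" "m \<notin> lang t" for m
  proof -
    have "p < t" using that p by (cases "p = t") simp_all
    then show ?thesis using t by (auto simp: step next_decoy_def)
  qed
next
  fix p
  assume "p \<in> {..t}" "lang p \<noteq> lang t"
  then have "p < t" by (cases "p = t") simp_all
  then have "2 * p \<in> lang p" "2 * p \<notin> lang t" "6 \<in> lang t" "2 * p < 6"
    using t decoy_less_3_diff[of p t] by (simp_all add: mem_decoy_iff)
  then show "\<exists>m u. m \<in> lang p \<and> m \<notin> lang t \<and> u \<in> lang t \<and> m < u" by blast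
qed

lemma hstep_reaches_idx:
  assumes trace: "is_trace (finlang i q) \<tau>"
  shows "\<exists>N. run hstep 0 \<tau> cex N = idx i 1"
proof -
  have "\<exists>n. \<tau> n = Some (2 * i + 1)"
    using trace by (auto simp: is_trace_def SMPL_def set_eq_iff)
  then obtain n where n: "\<tau> n = Some (2 * i + 1)" "\<And>k. k < n \<Longrightarrow> \<tau> k \<noteq> Some (2 * i + 1)"
    using exists_least_iff[of "\<lambda>n. \<tau> n = Some (2 * i + 1)"] by blast
  have "run hstep 0 \<tau> cex k < 3" if "k \<le> n" for k
    using that
  proof (induction k)
    case (Suc k)
    have "even y" if "y \<in> set_option (\<tau> k)" for y
      using that is_trace_subset[OF trace, of k] n(2)[of k] Suc.prems odd_mem_finlang[of y i q] by auto
    then have "run hstep 0 \<tau> cex (Suc k) = next_decoy (run hstep 0 \<tau> cex k) (cex k)"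
      using Suc by (simp add: hstep_decoy)
    then show ?case using Suc by (simp add: next_decoy_def)
  qed simp
  then have "run hstep 0 \<tau> cex (Suc n) = idx i 1" using n(1) hstep_marker by simp
  then show ?thesis ..
qed

lemma hstep_converges_level_0:
  assumes trace: "is_trace (lang (idx i 0)) \<tau>"
    and ok: "\<And>n. hcheck_ok (lang (idx i 0)) (lang (run hstep 0 \<tau> cex n)) (history \<tau> n) (cex n)"
  shows "converges_to lang (run hstep 0 \<tau> cex) (idx i 0)"
proof -
  obtain N where start: "run hstep 0 \<tau> cex N = idx i 1"
    using hstep_reaches_idx trace by (metis lang_idx)
  show ?thesis
  proof (rule hcheck_descent_converges[where N = N and S = "{idx i 0, idx i 1}" and rk = level,
        OF trace ok])
    show "run hstep 0 \<tau> cex N \<in> {idx i 0, idx i 1}" using start by simp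
    show "hstep p x None = p" if "p \<in> {idx i 0, idx i 1}" for p x
      using that by (auto simp: hstep_idx refine_def)
  next
    fix p x m t
    assume p: "p \<in> {idx i 0, idx i 1}" and m: "m \<in> lang p" "m \<notin> lang (idx i 0)"
      and t: "t \<in> lang (idx i 0)" "m < t"
    have "p = idx i 1" using p m by auto
    moreover have "t \<le> 2 * i + 1"
      using t(1) body_0_less[of "t div 2" i] by (auto simp: mem_finlang_iff)
    ultimately have "hstep p x (Some m) = idx i 0" using t(2) by (simp add: hstep_idx refine_def)
    then show "hstep p x (Some m) \<in> {idx i 0, idx i 1} \<and> level (hstep p x (Some m)) < level p"
      using \<open>p = idx i 1\<close> by simp
  next
    fix p
    assume "p \<in> {idx i 0, idx i 1}" "lang p \<noteq> lang (idx i 0)"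
    then have "2 * gap i \<in> lang p" "2 * gap i \<notin> lang (idx i 0)" "2 * i + 1 \<in> lang (idx i 0)"
        "2 * gap i < 2 * i + 1"
      using gap_le[of i] by (auto simp: gap_mem_body)
    then show "\<exists>m t. m \<in> lang p \<and> m \<notin> lang (idx i 0) \<and> t \<in> lang (idx i 0) \<and> m < t" by blast
  qed
qed

lemma hstep_converges_level_pos:
  assumes q: "0 < q" and trace: "is_trace (lang (idx i q)) \<tau>"
    and ok: "\<And>n. hcheck_ok (lang (idx i q)) (lang (run hstep 0 \<tau> cex n)) (history \<tau> n) (cex n)"
  shows "converges_to lang (run hstep 0 \<tau> cex) (idx i q)"
proof -
  obtain N where start: "run hstep 0 \<tau> cex N = idx i 1"
    using hstep_reaches_idx trace by (metis lang_idx)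
  show ?thesis
  proof (rule hcheck_descent_converges[where N = N and S = "idx i ` {1..q}" and
        rk = "\<lambda>p. q - level p", OF trace ok])
    show "run hstep 0 \<tau> cex N \<in> idx i ` {1..q}" using start q by simp
    show "hstep p x None = p" if "p \<in> idx i ` {1..q}" for p x
      using that by (auto simp: hstep_idx refine_def)
  next
    fix p x m
    assume p: "p \<in> idx i ` {1..q}" and m: "m \<in> lang p" "m \<notin> lang (idx i q)"
    then obtain r where r: "p = idx i r" "1 \<le> r" "r < q" by (force simp: le_less)
    then have "m = 2 * (i + r)" using m q by (auto simp: finlang_def body_def)
    then have "hstep p x (Some m) = idx i (r + 1)" using r by (simp add: hstep_idx refine_def)
    then show "hstep p x (Some m) \<in> idx i ` {1..q} \<and> q - level (hstep p x (Some m)) < q - level p"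
      using r by simp
  next
    fix p
    assume "p \<in> idx i ` {1..q}" "lang p \<noteq> lang (idx i q)"
    then obtain r where r: "p = idx i r" "1 \<le> r" "r < q" by (force simp: le_less)
    then have "i + r \<in> body i r" "i + r \<notin> body i q" "i + q \<in> body i q"
      by (simp_all add: top_mem_body)
    then have "2 * (i + r) \<in> lang p" "2 * (i + r) \<notin> lang (idx i q)" "2 * (i + q) \<in> lang (idx i q)"
      unfolding r(1) lang_idx even_mem_finlang .
    moreover have "2 * (i + r) < 2 * (i + q)" using r(3) by simp
    ultimately show "\<exists>m t. m \<in> lang p \<and> m \<notin> lang (idx i q) \<and> t \<in> lang (idx i q) \<and> m < t" by blast
  qed
qed

lemma in_HCEGIS_lang: "in_HCEGIS lang"
proof -
  have "hcegis_identifies lang hstep 0"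
    unfolding hcegis_identifies_def
  proof (intro allI impI)
    fix p \<tau> cex
    assume trace: "is_trace (lang p) \<tau>"
      and ok: "\<forall>n. hcheck_ok (lang p) (lang (run hstep 0 \<tau> cex n)) (history \<tau> n) (cex n)"
    show "converges_to lang (run hstep 0 \<tau> cex) p"
    proof (cases p rule: index_cases)
      case decoy
      then show ?thesis using hstep_converges_decoy trace ok by blast
    next
      case (finlang i q)
      then show ?thesis
        using hstep_converges_level_0 hstep_converges_level_pos trace ok by (cases "q = 0") blast+
    qed
  qed
  moreover have "engine lang hstep"
    unfolding engine_def using recursive_hstep inj_lang by (metis injD)
  ultimately show ?thesis unfolding in_HCEGIS_def using indexed_family_lang by blast
qed

section \<open>Failure of unbounded counterexamples\<close>

definition cegis_learns ::
  "(nat \<Rightarrow> nat set) \<Rightarrow> (nat \<Rightarrow> nat option \<Rightarrow> nat option \<Rightarrow> nat) \<Rightarrow> nat \<Rightarrow> nat \<Rightarrow> bool" where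
  "cegis_learns \<L> F p0 i \<longleftrightarrow>
     (\<forall>\<tau> cex. is_trace (\<L> i) \<tau> \<longrightarrow>
        (\<forall>n. check_ok (\<L> i) (\<L> (run F p0 \<tau> cex n)) (cex n)) \<longrightarrow>
        converges_to \<L> (run F p0 \<tau> cex) i)"

lemma cegis_identifies_iff_learns: "cegis_identifies \<L> F p0 \<longleftrightarrow> (\<forall>i. cegis_learns \<L> F p0 i)"
  by (simp add: cegis_identifies_def cegis_learns_def)

primrec play :: "('h \<Rightarrow> 'x \<Rightarrow> 'c \<Rightarrow> 'h) \<Rightarrow> ('h \<Rightarrow> 'c) \<Rightarrow> 'h \<Rightarrow> (nat \<Rightarrow> 'x) \<Rightarrow> nat \<Rightarrow> 'h" where
  "play F d p \<tau> 0 = p"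
| "play F d p \<tau> (Suc n) = F (play F d p \<tau> n) (\<tau> n) (d (play F d p \<tau> n))"

lemma run_eq_play: "run F p \<tau> (\<lambda>n. d (play F d p \<tau> n)) n = play F d p \<tau> n"
  by (induction n) auto

lemma play_cong:
  assumes "\<And>k. k < n \<Longrightarrow> \<tau> k = \<tau>' k" "\<And>k. k < n \<Longrightarrow> d (play F d p \<tau> k) = d' (play F d p \<tau> k)"
  shows "play F d p \<tau> n = play F d' p \<tau>' n"
  using assms
proof (induction n)
  case (Suc n)
  then have "play F d p \<tau> n = play F d' p \<tau>' n" by simp
  then show ?case using Suc.prems(1)[of n] Suc.prems(2)[of n] by simp
qed simp

lemma play_add: "play F d p \<tau> (n + k) = play F d (play F d p \<tau> n) (\<lambda>j. \<tau> (n + j)) k"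
  by (induction k) auto

lemma cegis_learns_play:
  assumes "cegis_learns \<L> F p0 i" "is_trace (\<L> i) \<tau>"
    and "\<And>n. check_ok (\<L> i) (\<L> (play F d p0 \<tau> n)) (d (play F d p0 \<tau> n))"
  shows "converges_to \<L> (play F d p0 \<tau>) i"
proof -
  have "converges_to \<L> (run F p0 \<tau> (\<lambda>n. d (play F d p0 \<tau> n))) i"
    using assms unfolding cegis_learns_def by (simp add: run_eq_play)
  then show ?thesis by (simp add: converges_to_def run_eq_play)
qed

definition first_visit ::
  "('h \<Rightarrow> 'x \<Rightarrow> 'c \<Rightarrow> 'h) \<Rightarrow> ('h \<Rightarrow> 'c) \<Rightarrow> 'h \<Rightarrow> (nat \<Rightarrow> 'x) \<Rightarrow> 'h \<Rightarrow> nat \<Rightarrow> bool" where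
  "first_visit F d p \<tau> t n \<longleftrightarrow> play F d p \<tau> n = t \<and> (\<forall>k<n. play F d p \<tau> k \<noteq> t)"

lemma ex_first_visit:
  assumes learns: "cegis_learns \<L> F p0 t" and inj: "inj \<L>" and trace: "is_trace (\<L> t) \<tau>"
    and d: "\<And>p. p \<noteq> t \<Longrightarrow> check_ok (\<L> t) (\<L> p) (d p)"
  shows "\<exists>n. first_visit F d p0 \<tau> t n"
proof -
  let ?d = "d(t := None)"
  have "check_ok (\<L> t) (\<L> p) (?d p)" for p using d by (simp add: check_ok_def)
  then have "converges_to \<L> (play F ?d p0 \<tau>) t" by (intro cegis_learns_play learns trace)
  then have "\<exists>n. play F ?d p0 \<tau> n = t" using inj by (auto simp: converges_to_def inj_eq)
  then obtain n where n: "play F ?d p0 \<tau> n = t" "\<And>k. k < n \<Longrightarrow> play F ?d p0 \<tau> k \<noteq> t"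
    using exists_least_iff[of "\<lambda>n. play F ?d p0 \<tau> n = t"] by blast
  have "play F ?d p0 \<tau> k = play F d p0 \<tau> k" if "k \<le> n" for k
    using that n(2) by (intro play_cong) auto
  then show ?thesis using n unfolding first_visit_def by (metis less_imp_le order_refl)
qed

definition prefix_then :: "nat \<Rightarrow> (nat \<Rightarrow> 'x) \<Rightarrow> (nat \<Rightarrow> 'x) \<Rightarrow> nat \<Rightarrow> 'x" where
  "prefix_then n \<tau> \<rho> k = (if k < n then \<tau> k else \<rho> (k - n))"

lemma SMPL_prefix_then: "SMPL (prefix_then n \<tau> \<rho>) = history \<tau> n \<union> SMPL \<rho>"
proof (intro set_eqI iffI)
  fix x
  assume "x \<in> SMPL (prefix_then n \<tau> \<rho>)"
  then show "x \<in> history \<tau> n \<union> SMPL \<rho>"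
    by (auto simp: SMPL_def history_def prefix_then_def split: if_splits)
next
  fix x
  assume "x \<in> history \<tau> n \<union> SMPL \<rho>"
  then consider (before) k where "k < n" "\<tau> k = Some x" | (after) k where "\<rho> k = Some x"
    by (auto simp: SMPL_def history_def)
  then show "x \<in> SMPL (prefix_then n \<tau> \<rho>)"
  proof cases
    case (before k)
    then have "prefix_then n \<tau> \<rho> k = Some x" by (simp add: prefix_then_def)
    then show ?thesis by (auto simp: SMPL_def)
  next
    case (after k)
    then have "prefix_then n \<tau> \<rho> (n + k) = Some x" by (simp add: prefix_then_def)
    then show ?thesis unfolding SMPL_def by blast
  qed
qed

lemma play_prefix_then:
  assumes "\<And>k. k < n \<Longrightarrow> d (play F d p \<tau> k) = d' (play F d p \<tau> k)"
  shows "k \<le> n \<Longrightarrow> play F d' p (prefix_then n \<tau> \<rho>) k = play F d p \<tau> k"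
    and "play F d' p (prefix_then n \<tau> \<rho>) (n + k) = play F d' (play F d p \<tau> n) \<rho> k"
proof -
  have prefix: "play F d' p (prefix_then n \<tau> \<rho>) k = play F d p \<tau> k" if "k \<le> n" for k
    using assms that by (intro play_cong[symmetric]) (auto simp: prefix_then_def)
  then show "k \<le> n \<Longrightarrow> play F d' p (prefix_then n \<tau> \<rho>) k = play F d p \<tau> k" .
  show "play F d' p (prefix_then n \<tau> \<rho>) (n + k) = play F d' (play F d p \<tau> n) \<rho> k"
    using prefix[of n] by (simp add: play_add prefix_then_def)
qed

text \<open>What was seen before the visit to \<open>t\<close> is forgotten: the play from \<open>t\<close> does not depend on \<open>\<tau>\<close>,
  but has to converge to whatever language \<open>\<tau>\<close> and \<open>\<rho>\<close> make up together.\<close>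

lemma cegis_learns_after_visit:
  assumes learns: "cegis_learns \<L> F p0 i" and visit: "play F d p0 \<tau> n = t"
    and agree: "\<And>k. k < n \<Longrightarrow> d (play F d p0 \<tau> k) = d' (play F d p0 \<tau> k)"
    and examples: "history \<tau> n \<union> SMPL \<rho> = \<L> i"
    and before: "\<And>k. k < n \<Longrightarrow> check_ok (\<L> i) (\<L> (play F d p0 \<tau> k)) (d' (play F d p0 \<tau> k))"
    and after: "\<And>k. check_ok (\<L> i) (\<L> (play F d' t \<rho> k)) (d' (play F d' t \<rho> k))"
  shows "converges_to \<L> (play F d' t \<rho>) i"
proof -
  let ?\<sigma> = "prefix_then n \<tau> \<rho>"
  have prefix: "play F d' p0 ?\<sigma> k = play F d p0 \<tau> k" if "k \<le> n" for k
    using that agree by (intro play_prefix_then(1)) auto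
  have rest: "play F d' p0 ?\<sigma> (n + k) = play F d' t \<rho> k" for k
    using play_prefix_then(2)[of n d F p0 \<tau> d' \<rho> k] agree visit by simp
  have "check_ok (\<L> i) (\<L> (play F d' p0 ?\<sigma> k)) (d' (play F d' p0 ?\<sigma> k))" for k
  proof (cases "k < n")
    case True
    then show ?thesis using before prefix[of k] by simp
  next
    case False
    then show ?thesis using after[of "k - n"] rest[of "k - n"] by simp
  qed
  moreover have "is_trace (\<L> i) ?\<sigma>" using examples by (simp add: is_trace_def SMPL_prefix_then)
  ultimately have "converges_to \<L> (play F d' p0 ?\<sigma>) i" by (intro cegis_learns_play learns)
  then obtain N where N: "\<And>k. N \<le> k \<Longrightarrow> \<L> (play F d' p0 ?\<sigma> k) = \<L> i"
    unfolding converges_to_def by blast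
  have "\<L> (play F d' t \<rho> k) = \<L> i" if "N \<le> k" for k
    using N[of "n + k"] that by (simp add: rest)
  then show ?thesis unfolding converges_to_def by blast
qed

definition canonical_trace :: "nat set \<Rightarrow> nat \<Rightarrow> nat option" where
  "canonical_trace L k = (if k \<in> L then Some k else None)"

lemma SMPL_canonical_trace [simp]: "SMPL (canonical_trace L) = L"
  by (auto simp: SMPL_def canonical_trace_def split: if_splits)

lemma history_canonical_trace: "history (canonical_trace L) n = L \<inter> {..<n}"
  by (auto simp: history_def canonical_trace_def split: if_splits)

lemma is_trace_canonical: "is_trace L (canonical_trace L)"
  by (simp add: is_trace_def)

text \<open>The answer \<open>neutral p\<close> is legal for all decoys other than \<open>p\<close> and for all kinds other than that
  of \<open>p\<close>; \<open>reply t i\<close> is legal for kind \<open>i\<close> and never reports its gap. The number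
  \<open>2 * (i + 3)\<close> belongs to \<open>decoy t\<close>, but to no \<open>finlang i q\<close> with \<open>q \<noteq> 3\<close>.\<close>

definition neutral :: "nat \<Rightarrow> nat option" where
  "neutral p = Some (if p < 3 then 2 * p else 2 * kind p + 1)"

definition reply :: "nat \<Rightarrow> nat \<Rightarrow> nat \<Rightarrow> nat option" where
  "reply t i p =
    (if p = t then Some (2 * (i + 3))
     else if p < 3 \<or> kind p \<noteq> i then neutral p
     else if level p = 0 then None
     else Some (2 * (i + level p)))"

lemma check_ok_SomeI: "m \<in> H \<Longrightarrow> m \<notin> L \<Longrightarrow> check_ok L H (Some m)"
  by (auto simp: check_ok_def)

lemma check_ok_neutral:
  assumes "t < 3" "p \<noteq> t"
  shows "check_ok (lang t) (lang p) (neutral p)"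
proof (cases p rule: index_cases)
  case decoy
  then have "2 * p \<in> decoy p - decoy t" using assms by (intro decoy_less_3_diff)
  then show ?thesis using decoy assms by (simp add: neutral_def check_ok_SomeI)
next
  case (finlang i q)
  then show ?thesis using assms by (simp add: neutral_def check_ok_SomeI mem_decoy_iff)
qed

lemma check_ok_reply_decoy:
  assumes p: "p < 3" and body: "body i q \<subseteq> insert t {3..}" and q: "q \<noteq> 3"
  shows "check_ok (finlang i q) (lang p) (reply t i p)"
proof (cases "p = t")
  case True
  have "i + 3 \<notin> body i q" using top_mem_body[of 3 i q] q by simp
  then have "2 * (i + 3) \<notin> finlang i q" unfolding even_mem_finlang .
  moreover have "2 * (i + 3) \<in> lang p" using p by (simp add: mem_decoy_iff)
  ultimately show ?thesis using True by (simp add: reply_def check_ok_SomeI)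
next
  case False
  then have "2 * p \<notin> finlang i q" using body p by auto
  then show ?thesis using False p by (simp add: reply_def neutral_def check_ok_SomeI mem_decoy_iff)
qed

lemma check_ok_reply_idx:
  assumes t: "t < 3" and unequal: "q = 0 \<or> idx j r \<noteq> idx i q"
  shows "check_ok (finlang i q) (finlang j r) (reply t i (idx j r))"
proof -
  have "idx j r \<noteq> t" using t not_idx_less_3[of j r] by metis
  consider (other_kind) "j \<noteq> i" | (level_0) "j = i" "r = 0" | (other_level) "j = i" "0 < r" "r \<noteq> q"
    using unequal by auto
  then show ?thesis
  proof cases
    case other_kind
    then show ?thesis
      using \<open>idx j r \<noteq> t\<close> by (simp add: reply_def neutral_def check_ok_SomeI)
  next
    case level_0
    have "finlang i 0 \<subseteq> finlang i q" by (auto simp: finlang_def body_def)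
    then show ?thesis using level_0 \<open>idx j r \<noteq> t\<close> by (simp add: reply_def check_ok_def)
  next
    case other_level
    then have "i + r \<in> body i r" "i + r \<notin> body i q" by (simp_all add: top_mem_body)
    then have "2 * (i + r) \<in> finlang i r" "2 * (i + r) \<notin> finlang i q"
      unfolding even_mem_finlang .
    then show ?thesis using other_level \<open>idx j r \<noteq> t\<close> by (simp add: reply_def check_ok_SomeI)
  qed
qed

lemma check_ok_reply:
  assumes "t < 3" "body i q \<subseteq> insert t {3..}" "q \<noteq> 3" "q = 0 \<or> p \<noteq> idx i q"
  shows "check_ok (finlang i q) (lang p) (reply t i p)"
  using assms check_ok_reply_decoy check_ok_reply_idx by (cases p rule: index_cases) auto

definition visited_kinds ::
  "(nat \<Rightarrow> nat option \<Rightarrow> nat option \<Rightarrow> nat) \<Rightarrow> nat \<Rightarrow> (nat \<Rightarrow> nat option) \<Rightarrow> nat \<Rightarrow> nat set" where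
  "visited_kinds F p0 \<tau> n = (\<lambda>k. kind (play F neutral p0 \<tau> k)) ` {..<n}"

lemma finite_visited_kinds: "finite (visited_kinds F p0 \<tau> n)"
  and card_visited_kinds_le: "card (visited_kinds F p0 \<tau> n) \<le> n"
  using card_image_le[of "{..<n}"] by (simp_all add: visited_kinds_def)

definition play_from_decoy ::
  "(nat \<Rightarrow> nat option \<Rightarrow> nat option \<Rightarrow> nat) \<Rightarrow> nat \<Rightarrow> nat \<Rightarrow> nat \<Rightarrow> nat" where
  "play_from_decoy F t i = play F (reply t i) t (canonical_trace (finlang i 0))"

lemma play_from_decoy_converges:
  assumes learns: "cegis_learns lang F p0 (idx i q)"
    and t: "t < 3" and visit: "first_visit F neutral p0 \<tau> t n"
    and i: "i \<notin> visited_kinds F p0 \<tau> n"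
    and body: "body i q \<subseteq> insert t {3..}" and q: "q \<noteq> 3"
    and examples: "history \<tau> n \<union> finlang i 0 = finlang i q"
    and unvisited: "q = 0 \<or> idx i q \<notin> range (play_from_decoy F t i)"
  shows "\<exists>N. \<forall>k\<ge>N. play_from_decoy F t i k = idx i q"
proof -
  let ?p = "play F neutral p0 \<tau>"
  have kinds: "kind (?p k) \<noteq> i" if "k < n" for k
    using i that by (auto simp: visited_kinds_def)
  have "converges_to lang (play F (reply t i) t (canonical_trace (finlang i 0))) (idx i q)"
  proof (rule cegis_learns_after_visit[OF learns])
    show "?p n = t" using visit by (simp add: first_visit_def)
    show "history \<tau> n \<union> SMPL (canonical_trace (finlang i 0)) = lang (idx i q)"
      using examples by simp
  next
    fix k
    assume k: "k < n"
    then have "?p k \<noteq> t" using visit by (simp add: first_visit_def)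
    then show "neutral (?p k) = reply t i (?p k)" using kinds[OF k] by (simp add: reply_def)
    have "?p k \<noteq> idx i q" using kinds[OF k] by auto
    then show "check_ok (lang (idx i q)) (lang (?p k)) (reply t i (?p k))"
      using check_ok_reply[OF t body q] by simp
  next
    fix k
    let ?h = "play F (reply t i) t (canonical_trace (finlang i 0)) k"
    have "q = 0 \<or> ?h \<noteq> idx i q" using unvisited by (metis play_from_decoy_def rangeI)
    then show "check_ok (lang (idx i q)) (lang ?h) (reply t i ?h)"
      using check_ok_reply[OF t body q] by simp
  qed
  then show ?thesis
    unfolding converges_to_def play_from_decoy_def inj_eq[OF inj_lang] .
qed

definition reached_levels :: "(nat \<Rightarrow> nat option \<Rightarrow> nat option \<Rightarrow> nat) \<Rightarrow> nat \<Rightarrow> nat \<Rightarrow> nat set" where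
  "reached_levels F t i = {q. idx i q \<in> range (play_from_decoy F t i)}"

lemma finite_reached_levels:
  assumes "cegis_learns lang F p0 (idx i 0)" "t < 3" "first_visit F neutral p0 \<tau> t n"
    and "i \<notin> visited_kinds F p0 \<tau> n" "base i \<subseteq> insert t {3..}"
    and "history \<tau> n \<subseteq> (*) 2 ` base i"
  shows "finite (reached_levels F t i)"
proof -
  have "\<exists>N. \<forall>k\<ge>N. play_from_decoy F t i k = idx i 0"
    using assms by (intro play_from_decoy_converges) (auto simp: body_def finlang_def)
  then obtain N where N: "\<And>k. N \<le> k \<Longrightarrow> play_from_decoy F t i k = idx i 0" by blast
  have "range (play_from_decoy F t i) \<subseteq> insert (idx i 0) (play_from_decoy F t i ` {..<N})"
    using N by (auto simp: image_iff) (metis lessThan_iff not_le)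
  then have "finite (range (play_from_decoy F t i))" by (rule finite_subset) simp
  moreover have "inj (idx i)" by (simp add: inj_def)
  ultimately have "finite (idx i -` range (play_from_decoy F t i))" by (rule finite_vimageI)
  then show ?thesis by (simp add: reached_levels_def vimage_def)
qed

lemma mem_reached_levels:
  assumes "cegis_learns lang F p0 (idx i q)" "t < 3" "first_visit F neutral p0 \<tau> t n"
    and "i \<notin> visited_kinds F p0 \<tau> n" "body i q \<subseteq> insert t {3..}" "q \<noteq> 3"
    and "history \<tau> n \<union> finlang i 0 = finlang i q"
  shows "q \<in> reached_levels F t i"
proof (rule ccontr)
  assume "q \<notin> reached_levels F t i"
  then have unvisited: "idx i q \<notin> range (play_from_decoy F t i)" by (simp add: reached_levels_def)
  then have "\<exists>N. \<forall>k\<ge>N. play_from_decoy F t i k = idx i q"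
    using play_from_decoy_converges[OF assms] by blast
  then show False using unvisited by (metis order_refl rangeI)
qed

definition segment :: "nat \<Rightarrow> nat \<Rightarrow> nat \<Rightarrow> nat set" where
  "segment t a b = insert t {3..<b} - {a}"

lemma infinite_kinds:
  assumes "finite D" "a \<notin> D"
  shows "infinite {i. base i = D \<and> gap i = a}"
proof -
  let ?c = "\<lambda>r. prod_encode (set_encode D, prod_encode (a, r))"
  have "range ?c \<subseteq> {i. base i = D \<and> gap i = a}"
    using assms by (auto simp: base_def gap_def)
  moreover have "infinite (range ?c)" by (simp add: finite_image_iff inj_def)
  ultimately show ?thesis by (rule infinite_super)
qed

text \<open>A single top \<open>y\<close> serves so many kinds at once that it need not be known beforehand which of them
  are going to be excluded.\<close>

definition shared_top :: "nat set \<Rightarrow> nat \<Rightarrow> (nat \<Rightarrow> nat set) \<Rightarrow> nat \<Rightarrow> nat \<Rightarrow> bool" where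
  "shared_top D a Q n y \<longleftrightarrow> (\<forall>V. finite V \<and> card V \<le> n \<longrightarrow>
     (\<exists>i q. base i = D \<and> gap i = a \<and> i \<notin> V \<and> 3 < q \<and> q \<notin> Q i \<and> y = i + q))"

lemma ex_shared_top:
  assumes D: "finite D" "a \<notin> D" and K: "finite K"
    and Q: "\<And>i. base i = D \<Longrightarrow> i \<notin> K \<Longrightarrow> finite (Q i)"
  shows "\<exists>y\<ge>b. shared_top D a Q n y"
proof -
  have "infinite ({i. base i = D \<and> gap i = a} - K)"
    using infinite_kinds[OF D] K by (rule Diff_infinite_finite[rotated])
  from infinite_arbitrarily_large[OF this, of "Suc n"]
  obtain I where I: "finite I" "card I = Suc n" "I \<subseteq> {i. base i = D \<and> gap i = a} - K" by blast
  have "\<exists>M. \<forall>q\<in>Q i. q < M" if "i \<in> I" for i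
    using Q[of i] I(3) that finite_nat_set_iff_bounded[of "Q i"] by auto
  then obtain M where M: "\<And>i q. i \<in> I \<Longrightarrow> q \<in> Q i \<Longrightarrow> q < M i" by metis
  define y where "y = Max (insert b ((\<lambda>i. i + M i + 4) ` I))"
  have y: "b \<le> y" "\<And>i. i \<in> I \<Longrightarrow> i + M i + 4 \<le> y"
    using I(1) by (simp_all add: y_def)
  have "shared_top D a Q n y"
    unfolding shared_top_def
  proof (intro allI impI)
    fix V :: "nat set"
    assume V: "finite V \<and> card V \<le> n"
    then have "\<not> I \<subseteq> V" using I(2) card_mono[of V I] by auto
    then obtain i where i: "i \<in> I" "i \<notin> V" by blast
    define q where "q = y - i"
    have "y = i + q" "3 < q" "M i < q" using y(2)[OF i(1)] by (simp_all add: q_def)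
    moreover have "q \<notin> Q i" using M[OF i(1), of q] \<open>M i < q\<close> by auto
    ultimately show "\<exists>i q. base i = D \<and> gap i = a \<and> i \<notin> V \<and> 3 < q \<and> q \<notin> Q i \<and> y = i + q"
      using i I(3) by blast
  qed
  then show ?thesis using y(1) by blast
qed

lemma not_shared_top_at_visit:
  assumes learns: "\<And>i q. cegis_learns lang F p0 (idx i q)"
    and t: "t < 3" and visit: "first_visit F neutral p0 \<tau> t m" and m: "m \<le> n"
    and bounds: "3 \<le> a" "3 \<le> y"
    and history: "history \<tau> m \<union> (*) 2 ` segment t a b = (*) 2 ` insert a (insert y (segment t a b))"
  shows "\<not> shared_top (segment t a b) a (reached_levels F t) n y"
proof
  assume "shared_top (segment t a b) a (reached_levels F t) n y"
  moreover have "card (visited_kinds F p0 \<tau> m) \<le> n"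
    using card_visited_kinds_le m by (rule le_trans)
  ultimately obtain i q where i: "base i = segment t a b" "gap i = a" "i \<notin> visited_kinds F p0 \<tau> m"
    and q: "3 < q" "y = i + q" and unreached: "q \<notin> reached_levels F t i"
    unfolding shared_top_def using finite_visited_kinds by blast
  have body: "body i q = insert a (insert y (segment t a b))"
    using i q by (auto simp: body_def)
  have "q \<in> reached_levels F t i"
  proof (rule mem_reached_levels[OF learns t visit i(3)])
    show "body i q \<subseteq> insert t {3..}" using bounds by (auto simp: body segment_def)
    show "q \<noteq> 3" using q(1) by simp
    show "history \<tau> m \<union> finlang i 0 = finlang i q"
      using history i(1) by (auto simp: finlang_def body_def[of i 0] body)
  qed
  then show False using unreached by blast
qed

lemma history_Some: "history (\<lambda>k. Some (f k)) n = f ` {..<n}"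
  by (auto simp: history_def)

lemma SMPL_Some: "SMPL (\<lambda>k. Some (f k)) = range f"
  by (auto simp: SMPL_def)

definition interleave :: "nat \<Rightarrow> nat \<Rightarrow> (nat \<Rightarrow> nat) \<Rightarrow> nat \<Rightarrow> nat" where
  "interleave t a y k = (case k of 0 \<Rightarrow> a
     | Suc j \<Rightarrow> if even j then y (j div 2) else if j div 2 \<in> insert t {3..} then j div 2 else a)"

lemma interleave_simps:
  "interleave t a y 0 = a"
  "interleave t a y (Suc (2 * n)) = y n"
  "interleave t a y (Suc (Suc (2 * n))) = (if n \<in> insert t {3..} then n else a)"
  by (simp_all add: interleave_def)

lemma position_cases [case_names zero odd even]:
  fixes k :: nat
  obtains "k = 0" | n where "k = Suc (2 * n)" | n where "k = Suc (Suc (2 * n))"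
proof (cases k)
  case (Suc j)
  then show thesis using that by (cases "even j") (auto elim: evenE oddE)
qed (use that in blast)

lemma range_interleave:
  assumes a: "3 \<le> a" and y: "\<And>n. 3 \<le> y n"
  shows "range (interleave t a y) = insert t {3..}"
proof (intro antisym subsetI)
  fix x
  assume "x \<in> range (interleave t a y)"
  then obtain k where k: "x = interleave t a y k" by blast
  show "x \<in> insert t {3..}"
    by (cases k rule: position_cases) (use k a y in \<open>simp_all add: interleave_simps\<close>)
next
  fix x
  assume "x \<in> insert t {3..}"
  then have "interleave t a y (Suc (Suc (2 * x))) = x" by (simp add: interleave_simps)
  then show "x \<in> range (interleave t a y)" by (metis rangeI)
qed

lemma interleave_prefix:
  assumes earlier: "\<And>j. j < n \<Longrightarrow> y j \<in> segment t a b" and n: "n < b"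
    and m: "m = 2 * n + 2 \<or> m = 2 * n + 3"
  shows "interleave t a y ` {..<m} \<union> segment t a b = insert a (insert (y n) (segment t a b))"
proof -
  have "interleave t a y k \<in> insert a (insert (y n) (segment t a b))" if "k < m" for k
  proof (cases k rule: position_cases)
    case zero
    then show ?thesis by (simp add: interleave_simps)
  next
    case (odd j)
    then have "j = n \<or> j < n" using m that by linarith
    then show ?thesis using odd earlier[of j] by (auto simp: interleave_simps)
  next
    case (even j)
    then have "j < b" using m n that by linarith
    then show ?thesis using even by (auto simp: interleave_simps segment_def)
  qed
  moreover have "a \<in> interleave t a y ` {..<m}"
    using m by (intro image_eqI[of _ _ 0]) (auto simp: interleave_simps)
  moreover have "y n \<in> interleave t a y ` {..<m}"
    using m by (intro image_eqI[of _ _ "Suc (2 * n)"]) (auto simp: interleave_simps)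
  ultimately show ?thesis by blast
qed

lemma ex_interlaced_bounds:
  assumes ex: "\<And>b n. b0 \<le> b \<Longrightarrow> \<exists>y\<ge>b. P n b y"
  obtains b y :: "nat \<Rightarrow> nat"
  where "\<forall>n. b0 + n \<le> b n \<and> b n \<le> y n \<and> P n (b n) (y n) \<and> (\<forall>j<n. y j < b n)"
proof -
  have "\<forall>n b. \<exists>y. b0 \<le> b \<longrightarrow> b \<le> y \<and> P n b y" using ex by blast
  then obtain Y where Y: "\<And>b n. b0 \<le> b \<Longrightarrow> b \<le> Y n b \<and> P n b (Y n b)" by metis
  define b where "b = rec_nat b0 (\<lambda>n b. Suc (Y n b))"
  define y where "y n = Y n (b n)" for n
  have b_Suc: "b (Suc n) = Suc (y n)" for n by (simp add: b_def y_def)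
  have b_ge: "b0 + n \<le> b n" for n
  proof (induction n)
    case (Suc n)
    then show ?case using Y[of "b n" n] by (simp add: b_Suc y_def)
  qed (simp add: b_def)
  have y: "b n \<le> y n" "P n (b n) (y n)" for n
    using Y[of "b n" n] b_ge[of n] by (simp_all add: y_def)
  have "strict_mono b" unfolding strict_mono_Suc_iff using y(1) by (simp add: b_Suc le_imp_less_Suc)
  then have "y j < b n" if "j < n" for j n
    using that strict_mono_less_eq[of b "Suc j" n] by (simp add: b_Suc)
  then show thesis using b_ge y by (intro that[of b y]) simp
qed

lemma ex_diagonal_trace:
  assumes a: "3 \<le> a" "a < b0" and ex: "\<And>b n. b0 \<le> b \<Longrightarrow> \<exists>y\<ge>b. P n b y"
  obtains \<tau> where "is_trace (decoy t) \<tau>" "\<tau> 0 = Some (2 * a)"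
    and "\<forall>n. \<exists>b y. b0 \<le> b \<and> b \<le> y \<and> P n b y \<and> (\<forall>m. m = 2 * n + 2 \<or> m = 2 * n + 3 \<longrightarrow>
      history \<tau> m \<union> (*) 2 ` segment t a b = (*) 2 ` insert a (insert y (segment t a b)))"
proof -
  obtain b y where
    seqs: "\<forall>n. b0 + n \<le> b n \<and> b n \<le> y n \<and> P n (b n) (y n) \<and> (\<forall>j<n. y j < b n)"
    using ex by (rule ex_interlaced_bounds)
  then have y_ge: "b0 \<le> y n" for n by (meson add_leD1 le_trans)
  let ?\<tau> = "\<lambda>k. Some (2 * interleave t a y k)"
  have "3 \<le> y n" for n using a y_ge[of n] by linarith
  then have "range (interleave t a y) = insert t {3..}" by (intro range_interleave a(1))
  then have trace: "is_trace (decoy t) ?\<tau>"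
    unfolding is_trace_def SMPL_Some decoy_def by (metis image_image)
  have prefix: "history ?\<tau> m \<union> (*) 2 ` segment t a (b n) =
      (*) 2 ` insert a (insert (y n) (segment t a (b n)))"
    if "m = 2 * n + 2 \<or> m = 2 * n + 3" for m n
  proof -
    have "y j \<in> segment t a (b n)" if "j < n" for j
      using a y_ge[of j] seqs that by (simp add: segment_def)
    moreover have "n < b n" using a seqs[rule_format, of n] by linarith
    ultimately show ?thesis
      using interleave_prefix[of n y t a "b n", OF _ _ that]
      unfolding history_Some by (metis image_Un image_image)
  qed
  have "b0 \<le> b n" "b n \<le> y n" "P n (b n) (y n)" for n
    using seqs[rule_format, of n] by simp_all
  then have "\<exists>b y. b0 \<le> b \<and> b \<le> y \<and> P n b y \<and> (\<forall>m. m = 2 * n + 2 \<or> m = 2 * n + 3 \<longrightarrow>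
      history ?\<tau> m \<union> (*) 2 ` segment t a b = (*) 2 ` insert a (insert y (segment t a b)))" for n
    by (intro exI[of _ "b n"] exI[of _ "y n"] conjI allI impI prefix)
  then show thesis by (intro that[of ?\<tau>] trace) (simp_all add: interleave_simps)
qed

lemma ex_late_decoy:
  assumes decoys: "\<And>t. t < 3 \<Longrightarrow> cegis_learns lang F p0 t"
    and level_0: "\<And>i. cegis_learns lang F p0 (idx i 0)"
  obtains t a b0 K where "t < 3" "3 \<le> a" "a < b0" "finite K"
    and "p0 \<noteq> t" "F p0 (Some (2 * a)) (neutral p0) \<noteq> t"
    and "\<forall>b\<ge>b0. \<forall>i. base i = segment t a b \<longrightarrow> i \<notin> K \<longrightarrow>
      finite (reached_levels F t i)"
proof -
  let ?\<tau> = "\<lambda>t. canonical_trace (decoy t)"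
  have "\<exists>n. first_visit F neutral p0 (?\<tau> t) t n" if "t < 3" for t
    using that by (intro ex_first_visit[OF decoys inj_lang] check_ok_neutral)
      (simp_all add: is_trace_canonical)
  then obtain n where n: "\<And>t. t < 3 \<Longrightarrow> first_visit F neutral p0 (?\<tau> t) t (n t)" by metis
  define a where "a = Suc (Max (insert 2 (n ` {..<3})))"
  have a: "3 \<le> a" "\<And>t. t < 3 \<Longrightarrow> n t < a"
    by (simp_all add: a_def less_Suc_eq_le)
  have "\<exists>t<3. u \<noteq> t \<and> v \<noteq> t" for u v :: nat by presburger
  from this[of p0 "F p0 (Some (2 * a)) (neutral p0)"]
  obtain t where t: "t < 3" "p0 \<noteq> t" "F p0 (Some (2 * a)) (neutral p0) \<noteq> t" by blast
  have "finite (reached_levels F t i)"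
    if "Suc a \<le> b" "base i = segment t a b" "i \<notin> visited_kinds F p0 (?\<tau> t) (n t)" for i b
  proof (rule finite_reached_levels[where n = "n t"])
    show "cegis_learns lang F p0 (idx i 0)" by (rule level_0)
    show "t < 3" by (rule t(1))
    show "first_visit F neutral p0 (?\<tau> t) t (n t)" by (rule n[OF t(1)])
    show "i \<notin> visited_kinds F p0 (?\<tau> t) (n t)" by (rule that(3))
    show "base i \<subseteq> insert t {3..}" unfolding that(2) by (auto simp: segment_def)
    have "k \<in> segment t a b" if "k \<in> insert t {3..}" "2 * k < n t" for k
      using that \<open>Suc a \<le> b\<close> a(2)[OF t(1)] by (auto simp: segment_def)
    then show "history (?\<tau> t) (n t) \<subseteq> (*) 2 ` base i"
      unfolding history_canonical_trace decoy_def that(2) by blast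
  qed
  then show thesis by (intro that[OF t(1) a(1) lessI finite_visited_kinds t(2,3)] allI impI)
qed

lemma not_cegis_identifies_lang: "\<not> cegis_identifies lang F p0"
proof
  assume "cegis_identifies lang F p0"
  then have learns: "cegis_learns lang F p0 p" for p by (simp add: cegis_identifies_iff_learns)
  obtain t a b0 K where t: "t < 3" and a: "3 \<le> a" "a < b0" and K: "finite K"
    and early: "p0 \<noteq> t" "F p0 (Some (2 * a)) (neutral p0) \<noteq> t"
    and levels: "\<forall>b\<ge>b0. \<forall>i. base i = segment t a b \<longrightarrow> i \<notin> K \<longrightarrow>
      finite (reached_levels F t i)"
    by (rule ex_late_decoy[OF learns learns])
  have "\<exists>y\<ge>b. shared_top (segment t a b) a (reached_levels F t) (2 * n + 3) y" if "b0 \<le> b" for b n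
  proof (rule ex_shared_top)
    show "finite (segment t a b)" "a \<notin> segment t a b" by (simp_all add: segment_def)
  qed (use K levels that in blast)+
  then obtain \<tau> where trace: "is_trace (decoy t) \<tau>" and start: "\<tau> 0 = Some (2 * a)"
    and stages: "\<forall>n. \<exists>b y. b0 \<le> b \<and> b \<le> y \<and>
      shared_top (segment t a b) a (reached_levels F t) (2 * n + 3) y \<and>
      (\<forall>m. m = 2 * n + 2 \<or> m = 2 * n + 3 \<longrightarrow>
        history \<tau> m \<union> (*) 2 ` segment t a b = (*) 2 ` insert a (insert y (segment t a b)))"
    by (rule ex_diagonal_trace[OF a])
  have "is_trace (lang t) \<tau>" using trace t by simp
  then obtain m where visit: "first_visit F neutral p0 \<tau> t m"
    using ex_first_visit[OF learns inj_lang _ check_ok_neutral[OF t]] by blast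
  have "m \<noteq> 0" using visit early(1) by (metis first_visit_def play.simps(1))
  moreover have "m \<noteq> 1" using visit early(2) start by (auto simp: first_visit_def)
  ultimately have "m = 2 * (m div 2 - 1) + 2 \<or> m = 2 * (m div 2 - 1) + 3" by presburger
  then obtain n where m: "m = 2 * n + 2 \<or> m = 2 * n + 3" by blast
  obtain b y where b: "b0 \<le> b" "b \<le> y"
    and shared: "shared_top (segment t a b) a (reached_levels F t) (2 * n + 3) y"
    and history: "history \<tau> m \<union> (*) 2 ` segment t a b = (*) 2 ` insert a (insert y (segment t a b))"
    using stages m by metis
  have "m \<le> 2 * n + 3" "3 \<le> y" using m a b by linarith+
  then have "\<not> shared_top (segment t a b) a (reached_levels F t) (2 * n + 3) y"
    by (intro not_shared_top_at_visit[OF learns t visit _ a(1) _ history])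
  then show False using shared by contradiction
qed

theorem lemma2:
  shows "\<exists>\<L>. indexed_family \<L> \<and> in_HCEGIS \<L> \<and> \<not> in_CEGIS \<L>"
  using indexed_family_lang in_HCEGIS_lang not_cegis_identifies_lang unfolding in_CEGIS_def by blast

end
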